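(* Algorithm 1 returns a $(1-O(\varepsilon))$-optimal solution to the packing LP $\max\{\langle\mathbf 1,x\rangle:Ax\le\mathbf 1,x\ge0\}$, and a $(1+O(\varepsilon))$-optimal solution to the covering LP $\min\{\langle\mathbf 1,y\rangle:A^\top y\ge\mathbf 1,y\ge0\}$.
   Context: Let $A\in\mathbb{R}^{m\times N}_{\ge0}$ be a nonnegative matrix with no zero column and $\varepsilon>0$. Algorithm 1 (Parallel MWU): set $\eta=\ln(m)/\varepsilon$, $x=\mathbf 0_N$, $w=\mathbf 1_m$, $\lambda=\min_j(A^\top w)_j$, $y=w/\lambda$. While $\|Ax\|_\infty<\eta$, perform one iteration: (i) if $\min_j(A^\top w)_j<(1+\varepsilon)\lambda$, let $B=\{j:(A^\top w)_j<(1+\varepsilon)\lambda\}$ and $B_0=\{j\in B:x_j=0\}$; if $B_0\ne\emptyset$ set $g_j=\varepsilon/(|B_0|\max_iA_{ij})$ for $j\in B_0$ and $g_j=0$ otherwise; else set $g_j=\delta x_j$ for $j\in B$ and $g_j=0$ otherwise, with $\delta>0$ chosen so that $\|Ag\|_\infty=\varepsilon$; then $x\gets x+g$ and $w\gets w\circ(\mathbf 1+Ag)$ (entrywise product). (ii) Otherwise set $\lambda\gets(1+\varepsilon)\lambda$, and if $\langle\mathbf 1,w\rangle/\lambda<\langle\mathbf 1,y\rangle$ set $y\gets w/\lambda$. Output $(x/\|Ax\|_\infty,y)$. A $(1-O(\varepsilon))$-optimal (resp. $(1+O(\varepsilon))$-optimal) solution is a feasible solution whose objective value is at least $(1-O(\varepsilon))$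 (resp. at most $(1+O(\varepsilon))$) times the optimal value. *)

theory Defs
  imports Complex_Main "Jordan_Normal_Form.Matrix" "HOL-Library.While_Combinator"
begin

text \<open>
  Vectors and matrices are those of \<open>Jordan_Normal_Form\<close>: their dimensions are numbers rather than
  types, so a statement can assert a constant that is uniform in the dimensions. The order on
  vectors and matrices there is entrywise.
\<close>

definition ones_vec :: "nat \<Rightarrow> real vec" where
  "ones_vec n = vec n (\<lambda>_. 1)"

definition min_entry :: "real vec \<Rightarrow> real" where
  "min_entry v = Min (set\<^sub>v v)"

definition max_entry :: "real vec \<Rightarrow> real" where
  "max_entry v = Max (set\<^sub>v v)"

definition linf_norm :: "real vec \<Rightarrow> real" where
  "linf_norm v = Max (abs ` set\<^sub>v v)"

definition entrywise_prod :: "real vec \<Rightarrow> real vec \<Rightarrow> real vec" where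
  "entrywise_prod v w = vec (dim_vec v) (\<lambda>i. v $ i * w $ i)"

definition entry_sum :: "real vec \<Rightarrow> real" where
  "entry_sum v = ones_vec (dim_vec v) \<bullet> v"


definition packing_feasible :: "real mat \<Rightarrow> real vec \<Rightarrow> bool" where
  "packing_feasible A x \<longleftrightarrow>
     x \<in> carrier_vec (dim_col A) \<and> 0\<^sub>v (dim_col A) \<le> x \<and> A *\<^sub>v x \<le> ones_vec (dim_row A)"

definition covering_feasible :: "real mat \<Rightarrow> real vec \<Rightarrow> bool" where
  "covering_feasible A y \<longleftrightarrow>
     y \<in> carrier_vec (dim_row A) \<and> 0\<^sub>v (dim_row A) \<le> y \<and> ones_vec (dim_col A) \<le> A\<^sup>T *\<^sub>v y"

text \<open>
  For a nonnegative matrix without zero columns both feasible regions are nonempty, the packing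
  objective is bounded above and the covering objective is bounded below, so the real-valued
  \<open>Sup\<close> and \<open>Inf\<close> below are the optimal values of the two linear programs.
\<close>

definition packing_opt :: "real mat \<Rightarrow> real" where
  "packing_opt A = Sup (entry_sum ` {x. packing_feasible A x})"

definition covering_opt :: "real mat \<Rightarrow> real" where
  "covering_opt A = Inf (entry_sum ` {y. covering_feasible A y})"

definition packing_optimal_within :: "real \<Rightarrow> real mat \<Rightarrow> real vec \<Rightarrow> bool" where
  "packing_optimal_within \<alpha> A x \<longleftrightarrow>
     packing_feasible A x \<and> entry_sum x \<ge> \<alpha> * packing_opt A"

definition covering_optimal_within :: "real \<Rightarrow> real mat \<Rightarrow> real vec \<Rightarrow> bool" where
  "covering_optimal_within \<alpha> A y \<longleftrightarrow>
     covering_feasible A y \<and> entry_sum y \<le> \<alpha> * covering_opt A"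


record mwu_state =
  mwu_x :: "real vec"
  mwu_w :: "real vec"
  mwu_lambda :: real
  mwu_y :: "real vec"

definition mwu_init :: "real mat \<Rightarrow> mwu_state" where
  "mwu_init A =
     (let w = ones_vec (dim_row A);
          l = min_entry (A\<^sup>T *\<^sub>v w)
      in \<lparr>mwu_x = 0\<^sub>v (dim_col A), mwu_w = w, mwu_lambda = l, mwu_y = (1 / l) \<cdot>\<^sub>v w\<rparr>)"

definition mwu_B :: "real mat \<Rightarrow> real \<Rightarrow> mwu_state \<Rightarrow> nat set" where
  "mwu_B A \<epsilon> s = {j. j < dim_col A \<and> (A\<^sup>T *\<^sub>v mwu_w s) $ j < (1 + \<epsilon>) * mwu_lambda s}"

definition mwu_B0 :: "real mat \<Rightarrow> real \<Rightarrow> mwu_state \<Rightarrow> nat set" where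
  "mwu_B0 A \<epsilon> s = {j \<in> mwu_B A \<epsilon> s. mwu_x s $ j = 0}"

definition mwu_scaled :: "real mat \<Rightarrow> real \<Rightarrow> mwu_state \<Rightarrow> real \<Rightarrow> real vec" where
  "mwu_scaled A \<epsilon> s \<delta> =
     vec (dim_col A) (\<lambda>j. if j \<in> mwu_B A \<epsilon> s then \<delta> * mwu_x s $ j else 0)"

definition mwu_g :: "real mat \<Rightarrow> real \<Rightarrow> mwu_state \<Rightarrow> real vec" where
  "mwu_g A \<epsilon> s =
     (let B0 = mwu_B0 A \<epsilon> s in
      if B0 \<noteq> {} then
        vec (dim_col A)
          (\<lambda>j. if j \<in> B0 then \<epsilon> / (real (card B0) * max_entry (col A j)) else 0)
      else
        mwu_scaled A \<epsilon> s (SOME \<delta>. \<delta> > 0 \<and> linf_norm (A *\<^sub>v mwu_scaled A \<epsilon> s \<delta>) = \<epsilon>))"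

definition mwu_step :: "real mat \<Rightarrow> real \<Rightarrow> mwu_state \<Rightarrow> mwu_state" where
  "mwu_step A \<epsilon> s =
     (if min_entry (A\<^sup>T *\<^sub>v mwu_w s) < (1 + \<epsilon>) * mwu_lambda s then
        let g = mwu_g A \<epsilon> s in
        s\<lparr>mwu_x := mwu_x s + g,
          mwu_w := entrywise_prod (mwu_w s) (ones_vec (dim_row A) + A *\<^sub>v g)\<rparr>
      else
        let l = (1 + \<epsilon>) * mwu_lambda s in
        s\<lparr>mwu_lambda := l,
          mwu_y := (if entry_sum (mwu_w s) / l < entry_sum (mwu_y s)
                    then (1 / l) \<cdot>\<^sub>v mwu_w s else mwu_y s)\<rparr>)"

definition mwu_guard :: "real mat \<Rightarrow> real \<Rightarrow> mwu_state \<Rightarrow> bool" where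
  "mwu_guard A \<epsilon> s \<longleftrightarrow> linf_norm (A *\<^sub>v mwu_x s) < ln (real (dim_row A)) / \<epsilon>"

definition mwu_output :: "real mat \<Rightarrow> mwu_state \<Rightarrow> real vec \<times> real vec" where
  "mwu_output A s = ((1 / linf_norm (A *\<^sub>v mwu_x s)) \<cdot>\<^sub>v mwu_x s, mwu_y s)"

text \<open>The result is \<open>None\<close> iff the loop does not terminate.\<close>

definition parallel_mwu :: "real mat \<Rightarrow> real \<Rightarrow> (real vec \<times> real vec) option" where
  "parallel_mwu A \<epsilon> =
     map_option (mwu_output A) (while_option (mwu_guard A \<epsilon>) (mwu_step A \<epsilon>) (mwu_init A))"

end

theory Submission
  imports Defs
begin

text \<open>
  Writing \<open>W = \<langle>1, w\<rangle>\<close>, an increment \<open>g\<close> is supported on columns of cost less than \<open>(1 + \<epsilon>) \<lambda>\<close>, and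
  \<open>\<langle>1, y\<rangle> \<le> W / \<lambda>\<close> holds throughout, so \<open>W\<close> grows by a factor of at most
  \<open>1 + (1 + \<epsilon>) \<langle>1, g\<rangle> / \<langle>1, y\<rangle>\<close>; hence \<open>ln W \<le> ln m + (1 + \<epsilon>) \<langle>1, x\<rangle> / \<langle>1, y\<rangle>\<close>. Since
  \<open>A g \<le> \<epsilon>\<close>, conversely \<open>ln W \<ge> \<parallel>A x\<parallel> / (1 + \<epsilon>)\<close>. At termination \<open>ln m \<le> \<epsilon> \<parallel>A x\<parallel>\<close>, and the two
  bounds give \<open>\<langle>1, x\<rangle> / \<parallel>A x\<parallel> \<ge> (1 - 3 \<epsilon>) \<langle>1, y\<rangle>\<close>. Both outputs are feasible, so weak duality
  bounds both approximation factors.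
\<close>

section \<open>Entry sums, extremal entries and the maximum norm\<close>

lemma entry_sum_eq: "entry_sum v = (\<Sum>i<dim_vec v. v $ i)"
  by (simp add: entry_sum_def ones_vec_def scalar_prod_def atLeast0LessThan)

lemma entry_sum_smult: "entry_sum (c \<cdot>\<^sub>v v) = c * entry_sum v"
  by (simp add: entry_sum_eq sum_distrib_left)

lemma entry_sum_add:
  assumes "dim_vec u = dim_vec v"
  shows "entry_sum (u + v) = entry_sum u + entry_sum v"
  using assms by (simp add: entry_sum_eq sum.distrib)

lemma abs_index_le_linf_norm: "i < dim_vec v \<Longrightarrow> \<bar>v $ i\<bar> \<le> linf_norm v"
  unfolding linf_norm_def by (rule Max_ge) (auto simp: vec_set_def)

lemma linf_norm_attained:
  assumes "dim_vec v > 0"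
  obtains i where "i < dim_vec v" "linf_norm v = \<bar>v $ i\<bar>"
proof -
  have "linf_norm v \<in> abs ` set\<^sub>v v"
    unfolding linf_norm_def using assms by (intro Max_in) (auto simp: vec_set_def)
  then show ?thesis using that by (auto simp: vec_set_def)
qed

lemma linf_norm_smult:
  assumes "dim_vec v > 0"
  shows "linf_norm (c \<cdot>\<^sub>v v) = \<bar>c\<bar> * linf_norm v"
proof (rule antisym)
  obtain i where "i < dim_vec v" "linf_norm (c \<cdot>\<^sub>v v) = \<bar>(c \<cdot>\<^sub>v v) $ i\<bar>"
    using linf_norm_attained[of "c \<cdot>\<^sub>v v"] assms by auto
  then show "linf_norm (c \<cdot>\<^sub>v v) \<le> \<bar>c\<bar> * linf_norm v"
    using abs_index_le_linf_norm[of i v] by (simp add: abs_mult mult_left_mono)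
next
  obtain i where i: "i < dim_vec v" "linf_norm v = \<bar>v $ i\<bar>"
    using linf_norm_attained assms by blast
  then show "\<bar>c\<bar> * linf_norm v \<le> linf_norm (c \<cdot>\<^sub>v v)"
    using abs_index_le_linf_norm[of i "c \<cdot>\<^sub>v v"] by (simp add: abs_mult)
qed

lemma min_entry_le: "i < dim_vec v \<Longrightarrow> min_entry v \<le> v $ i"
  unfolding min_entry_def by (rule Min_le) (auto simp: vec_set_def)

lemma min_entry_attained:
  assumes "dim_vec v > 0"
  obtains i where "i < dim_vec v" "min_entry v = v $ i"
proof -
  have "min_entry v \<in> set\<^sub>v v"
    unfolding min_entry_def using assms by (intro Min_in) (auto simp: vec_set_def)
  then show ?thesis using that by (auto simp: vec_set_def)
qed

lemma le_max_entry: "i < dim_vec v \<Longrightarrow> v $ i \<le> max_entry v"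
  unfolding max_entry_def by (rule Max_ge) (auto simp: vec_set_def)

lemma max_entry_attained:
  assumes "dim_vec v > 0"
  obtains i where "i < dim_vec v" "max_entry v = v $ i"
proof -
  have "max_entry v \<in> set\<^sub>v v"
    unfolding max_entry_def using assms by (intro Max_in) (auto simp: vec_set_def)
  then show ?thesis using that by (auto simp: vec_set_def)
qed

text \<open>Applying \<open>ln u \<le> u - 1\<close> to the reciprocal of \<open>1 + t\<close> gives
  \<open>ln (1 + t) \<ge> t / (1 + t)\<close>, and enlarging the denominator to \<open>1 + e\<close>
  makes the factor uniform. With \<open>e = \<epsilon>\<close> this is how one update of a weight
  preserves the lower bound on its logarithm.\<close>

lemma divide_le_ln_one_plus:
  fixes t e :: real
  assumes "0 \<le> t" "t \<le> e"
  shows "t / (1 + e) \<le> ln (1 + t)"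
proof -
  have "t / (1 + e) \<le> t / (1 + t)"
    using assms by (intro divide_left_mono) (auto intro: mult_pos_pos)
  also have "t / (1 + t) = 1 - 1 / (1 + t)"
    using assms by (simp add: field_simps)
  also have "\<dots> \<le> ln (1 + t)"
    using ln_le_minus_one[of "1 / (1 + t)"] assms by (simp add: ln_div)
  finally show ?thesis .
qed

section \<open>Weak duality and the approximation factors\<close>

text \<open>With \<open>2 \<le> m\<close> the threshold \<open>ln m / \<epsilon>\<close> is
  positive, so the loop cannot stop at \<open>x = 0\<close>, where the final rescaling would be
  meaningless. No upper bound is put on \<epsilon>.\<close>

locale mwu_instance =
  fixes A :: "real mat" and m N :: nat and \<epsilon> :: real
  assumes A_carrier: "A \<in> carrier_mat m N"
    and A_nonneg: "\<And>i j. i < m \<Longrightarrow> j < N \<Longrightarrow> 0 \<le> A $$ (i, j)"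
    and col_nonzero: "\<And>j. j < N \<Longrightarrow> \<exists>i<m. 0 < A $$ (i, j)"
    and m_ge_2: "2 \<le> m"
    and N_ge_1: "1 \<le> N"
    and eps_pos: "0 < \<epsilon>"
begin

lemma dims [simp]: "dim_row A = m" "dim_col A = N"
  using A_carrier by auto

lemma index_mult:
  assumes "dim_vec x = N" "i < m"
  shows "(A *\<^sub>v x) $ i = (\<Sum>j<N. A $$ (i, j) * x $ j)"
  using assms by (simp add: scalar_prod_def atLeast0LessThan)

lemma index_transpose_mult:
  assumes "dim_vec w = m" "j < N"
  shows "(A\<^sup>T *\<^sub>v w) $ j = (\<Sum>i<m. A $$ (i, j) * w $ i)"
  using assms by (simp add: scalar_prod_def atLeast0LessThan)

text \<open>Serves twice: for weak duality, and to express the growth of the total weight through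
  the costs of the columns in an increment.\<close>

lemma sum_mult_transpose:
  assumes "dim_vec x = N" "dim_vec w = m"
  shows "(\<Sum>i<m. w $ i * (A *\<^sub>v x) $ i) = (\<Sum>j<N. (A\<^sup>T *\<^sub>v w) $ j * x $ j)"
proof -
  have "(\<Sum>i<m. w $ i * (A *\<^sub>v x) $ i) = (\<Sum>i<m. \<Sum>j<N. w $ i * (A $$ (i, j) * x $ j))"
    by (rule sum.cong) (simp_all add: index_mult[OF assms(1)] sum_distrib_left del: index_mult_mat_vec)
  also have "\<dots> = (\<Sum>j<N. \<Sum>i<m. w $ i * (A $$ (i, j) * x $ j))"
    by (rule sum.swap)
  also have "\<dots> = (\<Sum>j<N. (A\<^sup>T *\<^sub>v w) $ j * x $ j)"
    by (rule sum.cong)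
      (simp_all add: index_transpose_mult[OF assms(2)] sum_distrib_left mult_ac del: index_mult_mat_vec)
  finally show ?thesis .
qed

lemma mult_nonneg:
  assumes "dim_vec x = N" "\<And>j. j < N \<Longrightarrow> 0 \<le> x $ j" "i < m"
  shows "0 \<le> (A *\<^sub>v x) $ i"
  unfolding index_mult[OF assms(1,3)] using assms A_nonneg by (intro sum_nonneg) auto

lemma entry_le_mult:
  assumes "dim_vec x = N" "\<And>j. j < N \<Longrightarrow> 0 \<le> x $ j" "i < m" "j < N"
  shows "A $$ (i, j) * x $ j \<le> (A *\<^sub>v x) $ i"
  unfolding index_mult[OF assms(1,3)]
  using assms A_nonneg by (intro member_le_sum[of j "{..<N}" "\<lambda>j. A $$ (i, j) * x $ j"]) auto

lemma transpose_mult_mono: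
  assumes "dim_vec w = m" "dim_vec w' = m" "\<And>i. i < m \<Longrightarrow> w $ i \<le> w' $ i" "j < N"
  shows "(A\<^sup>T *\<^sub>v w) $ j \<le> (A\<^sup>T *\<^sub>v w') $ j"
  unfolding index_transpose_mult[OF assms(1,4)] index_transpose_mult[OF assms(2,4)]
  using assms A_nonneg by (intro sum_mono mult_left_mono) auto

lemma packing_feasible_iff:
  "packing_feasible A x \<longleftrightarrow>
     dim_vec x = N \<and> (\<forall>j<N. 0 \<le> x $ j) \<and> (\<forall>i<m. (A *\<^sub>v x) $ i \<le> 1)"
  unfolding packing_feasible_def less_eq_vec_def ones_vec_def carrier_vec_def dims
  by (simp del: index_mult_mat_vec cong: conj_cong)

lemma covering_feasible_iff:
  "covering_feasible A y \<longleftrightarrow>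
     dim_vec y = m \<and> (\<forall>i<m. 0 \<le> y $ i) \<and> (\<forall>j<N. 1 \<le> (A\<^sup>T *\<^sub>v y) $ j)"
  unfolding covering_feasible_def less_eq_vec_def ones_vec_def carrier_vec_def dims
  by (simp del: index_mult_mat_vec cong: conj_cong)

lemma weak_duality:
  assumes "packing_feasible A x" "covering_feasible A y"
  shows "entry_sum x \<le> entry_sum y"
proof -
  have x: "dim_vec x = N" "\<And>j. j < N \<Longrightarrow> 0 \<le> x $ j" "\<And>i. i < m \<Longrightarrow> (A *\<^sub>v x) $ i \<le> 1"
    using assms(1) unfolding packing_feasible_iff by blast+
  have y: "dim_vec y = m" "\<And>i. i < m \<Longrightarrow> 0 \<le> y $ i" "\<And>j. j < N \<Longrightarrow> 1 \<le> (A\<^sup>T *\<^sub>v y) $ j"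
    using assms(2) unfolding covering_feasible_iff by blast+
  have "entry_sum x \<le> (\<Sum>j<N. (A\<^sup>T *\<^sub>v y) $ j * x $ j)"
    unfolding entry_sum_eq x(1)
  proof (rule sum_mono)
    fix j assume "j \<in> {..<N}"
    then have "1 * x $ j \<le> (A\<^sup>T *\<^sub>v y) $ j * x $ j" by (intro mult_right_mono x(2) y(3)) simp_all
    then show "x $ j \<le> (A\<^sup>T *\<^sub>v y) $ j * x $ j" by simp
  qed
  also have "\<dots> = (\<Sum>i<m. y $ i * (A *\<^sub>v x) $ i)"
    by (rule sum_mult_transpose[OF x(1) y(1), symmetric])
  also have "\<dots> \<le> entry_sum y"
    unfolding entry_sum_eq y(1)
  proof (rule sum_mono)
    fix i assume "i \<in> {..<m}"
    then have "y $ i * (A *\<^sub>v x) $ i \<le> y $ i * 1" by (intro mult_left_mono y(2) x(3)) simp_all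
    then show "y $ i * (A *\<^sub>v x) $ i \<le> y $ i" by simp
  qed
  finally show ?thesis .
qed

text \<open>Makes the set under the conditionally complete \<open>Sup\<close> nonempty and shows
  that the packing optimum is nonnegative.\<close>

lemma zero_packing_feasible: "packing_feasible A (0\<^sub>v N)"
  by (simp add: packing_feasible_iff index_mult del: index_mult_mat_vec)

lemma packing_opt_le:
  assumes "covering_feasible A y"
  shows "packing_opt A \<le> entry_sum y"
  unfolding packing_opt_def
  using zero_packing_feasible weak_duality[OF _ assms] by (intro cSup_least) auto

lemma packing_opt_nonneg:
  assumes "covering_feasible A y"
  shows "0 \<le> packing_opt A"
proof -
  have "bdd_above (entry_sum ` {x. packing_feasible A x})"
    using weak_duality[OF _ assms] by (intro bdd_aboveI[of _ "entry_sum y"]) auto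
  then have "entry_sum (0\<^sub>v N) \<le> packing_opt A"
    unfolding packing_opt_def using zero_packing_feasible by (intro cSup_upper) auto
  then show ?thesis by (simp add: entry_sum_eq)
qed

lemma covering_opt_ge:
  assumes "packing_feasible A x" "covering_feasible A y"
  shows "entry_sum x \<le> covering_opt A"
  unfolding covering_opt_def
  using weak_duality[OF assms(1)] assms(2) by (intro cInf_greatest) auto

text \<open>By weak duality \<open>packing_opt A\<close> is at most \<open>entry_sum y\<close> and
  \<open>covering_opt A\<close> is at least \<open>entry_sum x\<close>. The packing bound already
  holds with 3; the constant 6 comes from inverting the gap, since \<open>(1 + 6 * \<epsilon>) * (1
  - 3 * \<epsilon>) = 1 + 3 * \<epsilon> * (1 - 6 * \<epsilon>)\<close> is at least 1 exactly when
  \<open>\<epsilon> \<le> 1 / 6\<close>.\<close>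

lemma near_tight_pair_optimal:
  assumes x: "packing_feasible A x" and y: "covering_feasible A y"
    and gap: "(1 - 3 * \<epsilon>) * entry_sum y \<le> entry_sum x"
  shows "packing_optimal_within (1 - 6 * \<epsilon>) A x"
    and "\<epsilon> \<le> 1 / 6 \<Longrightarrow> covering_optimal_within (1 + 6 * \<epsilon>) A y"
proof -
  have x0: "0 \<le> entry_sum x"
    using x by (auto simp: packing_feasible_iff entry_sum_eq intro: sum_nonneg)
  note opt = packing_opt_nonneg[OF y] packing_opt_le[OF y]
  have "(1 - 6 * \<epsilon>) * packing_opt A \<le> entry_sum x"
  \<comment> \<open>Multiplying the two inequalities needs a nonnegative factor. For larger
    \<epsilon> the left side is nonpositive and the claim is trivial.\<close>
  proof (cases "1 - 6 * \<epsilon> \<le> 0")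
    case True
    then show ?thesis using opt(1) x0 mult_nonpos_nonneg by (smt (verit))
  next
    case False
    then have "(1 - 6 * \<epsilon>) * packing_opt A \<le> (1 - 3 * \<epsilon>) * entry_sum y"
      using opt eps_pos by (intro mult_mono) auto
    with gap show ?thesis by simp
  qed
  with x show "packing_optimal_within (1 - 6 * \<epsilon>) A x"
    by (simp add: packing_optimal_within_def)
  assume e: "\<epsilon> \<le> 1 / 6"
  have y0: "0 \<le> entry_sum y"
    using y by (auto simp: covering_feasible_iff entry_sum_eq intro: sum_nonneg)
  have "0 \<le> 3 * \<epsilon> * (1 - 6 * \<epsilon>)" using e eps_pos by simp
  then have "1 \<le> (1 + 6 * \<epsilon>) * (1 - 3 * \<epsilon>)" by (simp add: algebra_simps)
  then have "entry_sum y \<le> (1 + 6 * \<epsilon>) * (1 - 3 * \<epsilon>) * entry_sum y"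
    using y0 mult_right_mono by fastforce
  also have "\<dots> \<le> (1 + 6 * \<epsilon>) * covering_opt A"
    unfolding mult.assoc using gap covering_opt_ge[OF x y] eps_pos by (intro mult_left_mono) auto
  finally show "covering_optimal_within (1 + 6 * \<epsilon>) A y"
    using y by (simp add: covering_optimal_within_def)
qed

section \<open>The loop invariant\<close>

text \<open>The lower bound on \<open>ln w\<close> and the last conjunct are the two estimates
  compared at exit. The upper bounds on \<open>ln w\<close> and on \<open>mwu_lambda\<close> serve
  termination: together they keep \<open>mwu_lambda\<close> bounded while the guard holds. The bound
  of \<open>entry_sum y\<close> by \<open>entry_sum w / mwu_lambda\<close> lets the growth of the
  total weight be measured against the current dual value.\<close>

definition mwu_inv :: "mwu_state \<Rightarrow> bool" where
  "mwu_inv s \<longleftrightarrow>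
     dim_vec (mwu_x s) = N \<and> dim_vec (mwu_w s) = m \<and>
     (\<forall>j<N. 0 \<le> mwu_x s $ j) \<and>
     (\<forall>i<m. 0 < mwu_w s $ i) \<and>
     (\<forall>i<m. (A *\<^sub>v mwu_x s) $ i / (1 + \<epsilon>) \<le> ln (mwu_w s $ i)) \<and>
     (\<forall>i<m. ln (mwu_w s $ i) \<le> (A *\<^sub>v mwu_x s) $ i) \<and>
     0 < mwu_lambda s \<and>
     (\<forall>j<N. mwu_lambda s \<le> (A\<^sup>T *\<^sub>v mwu_w s) $ j) \<and>
     covering_feasible A (mwu_y s) \<and> 0 < entry_sum (mwu_y s) \<and>
     entry_sum (mwu_y s) \<le> entry_sum (mwu_w s) / mwu_lambda s \<and>
     ln (entry_sum (mwu_w s))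
       \<le> ln m + (1 + \<epsilon>) * entry_sum (mwu_x s) / entry_sum (mwu_y s)"

lemma entry_sum_pos:
  assumes "dim_vec w = m" "\<And>i. i < m \<Longrightarrow> 0 < w $ i"
  shows "0 < entry_sum w"
  unfolding entry_sum_eq using assms m_ge_2
  by (intro sum_pos) (auto simp: lessThan_empty_iff)

lemma rescaled_covering_feasible:
  assumes "dim_vec w = m" "\<And>i. i < m \<Longrightarrow> 0 < w $ i" "0 < l"
    "\<And>j. j < N \<Longrightarrow> l \<le> (A\<^sup>T *\<^sub>v w) $ j"
  shows "covering_feasible A ((1 / l) \<cdot>\<^sub>v w)"
proof -
  have "(A\<^sup>T *\<^sub>v ((1 / l) \<cdot>\<^sub>v w)) $ j = (A\<^sup>T *\<^sub>v w) $ j / l" if "j < N" for j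
    using that assms(1) by (simp add: index_transpose_mult sum_divide_distrib del: index_mult_mat_vec)
  then show ?thesis
    using assms by (auto simp: covering_feasible_iff less_imp_le simp del: index_mult_mat_vec)
qed

lemma mwu_inv_init: "mwu_inv (mwu_init A)"
proof -
  let ?w = "ones_vec m" and ?l = "min_entry (A\<^sup>T *\<^sub>v ones_vec m)"
  have w: "dim_vec ?w = m" "\<And>i. i < m \<Longrightarrow> ?w $ i = 1" by (auto simp: ones_vec_def)
  have le: "?l \<le> (A\<^sup>T *\<^sub>v ?w) $ j" if "j < N" for j
    using min_entry_le[of j "A\<^sup>T *\<^sub>v ?w"] that by simp
  obtain j where j: "j < N" "?l = (A\<^sup>T *\<^sub>v ?w) $ j"
    using min_entry_attained[of "A\<^sup>T *\<^sub>v ?w"] N_ge_1 by (auto simp del: index_mult_mat_vec)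
  \<comment> \<open>The initial \<lambda> is positive because even the cheapest column has a
    positive entry.\<close>
  obtain i where i: "i < m" "0 < A $$ (i, j)" using col_nonzero j by blast
  have "0 < (\<Sum>i<m. A $$ (i, j) * ?w $ i)"
    using i j A_nonneg by (intro sum_pos2[of _ i]) (auto simp: w)
  then have lpos: "0 < ?l" using j w by (simp add: index_transpose_mult del: index_mult_mat_vec)
  have cf: "covering_feasible A ((1 / ?l) \<cdot>\<^sub>v ?w)"
    using w lpos le by (intro rescaled_covering_feasible) auto
  have sw: "entry_sum ?w = m" using w by (simp add: entry_sum_eq)
  have Ax: "(A *\<^sub>v 0\<^sub>v N) $ i = 0" if "i < m" for i
    using that by (simp add: index_mult del: index_mult_mat_vec)
  have init: "mwu_x (mwu_init A) = 0\<^sub>v N" "mwu_w (mwu_init A) = ?w"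
    "mwu_lambda (mwu_init A) = ?l" "mwu_y (mwu_init A) = (1 / ?l) \<cdot>\<^sub>v ?w"
    by (simp_all add: mwu_init_def Let_def)
  have sy: "entry_sum ((1 / ?l) \<cdot>\<^sub>v ?w) = m / ?l" by (simp add: entry_sum_smult sw)
  have sx: "entry_sum (0\<^sub>v N) = 0" by (simp add: entry_sum_eq)
  have m_pos: "0 < real m" using m_ge_2 by simp
  show ?thesis
    unfolding mwu_inv_def init sy sx sw
    by (intro conjI allI impI cf le lpos w(1) divide_pos_pos m_pos) (simp_all add: w(2) Ax lpos m_pos del: index_mult_mat_vec)
qed

section \<open>One iteration of the loop\<close>

text \<open>Extracts what both forms of the increment have in common, so that the later analysis
  needs no case distinction. The last property drives termination; its factor \<open>1 / N\<close>
  is lost when \<epsilon> is shared among up to \<open>N\<close> columns of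
  \<open>mwu_B0\<close>.\<close>

lemma mwu_increment:
  assumes inv: "mwu_inv s"
    and cheap: "min_entry (A\<^sup>T *\<^sub>v mwu_w s) < (1 + \<epsilon>) * mwu_lambda s"
  defines "g \<equiv> mwu_g A \<epsilon> s"
  shows "dim_vec g = N"
    and "\<And>j. j < N \<Longrightarrow> 0 \<le> g $ j"
    and "\<And>j. j < N \<Longrightarrow> j \<notin> mwu_B A \<epsilon> s \<Longrightarrow> g $ j = 0"
    and "\<And>i. i < m \<Longrightarrow> (A *\<^sub>v g) $ i \<le> \<epsilon>"
    and "\<exists>i<m. \<epsilon> / N \<le> (A *\<^sub>v g) $ i"
proof -
  let ?B = "mwu_B A \<epsilon> s" and ?Z = "mwu_B0 A \<epsilon> s" and ?x = "mwu_x s"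
  have x: "dim_vec ?x = N" "\<And>j. j < N \<Longrightarrow> 0 \<le> ?x $ j"
    using inv by (auto simp: mwu_inv_def)
  have B_sub: "?B \<subseteq> {..<N}" by (auto simp: mwu_B_def)
  have B0_sub: "?Z \<subseteq> ?B" by (auto simp: mwu_B0_def)
  \<comment> \<open>The column of least cost passes the test, so \<open>mwu_B\<close> is
    nonempty.\<close>
  obtain j0 where "j0 < N" "min_entry (A\<^sup>T *\<^sub>v mwu_w s) = (A\<^sup>T *\<^sub>v mwu_w s) $ j0"
    using min_entry_attained[of "A\<^sup>T *\<^sub>v mwu_w s"] N_ge_1 by (auto simp del: index_mult_mat_vec)
  then have j0: "j0 \<in> ?B" using cheap by (simp add: mwu_B_def del: index_mult_mat_vec)
  have "dim_vec g = N \<and> (\<forall>j<N. 0 \<le> g $ j) \<and> (\<forall>j<N. j \<notin> ?B \<longrightarrow> g $ j = 0) \<and>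
    (\<forall>i<m. (A *\<^sub>v g) $ i \<le> \<epsilon>) \<and> (\<exists>i<m. \<epsilon> / N \<le> (A *\<^sub>v g) $ i)"
  proof (cases "?Z = {}")
    case False
    let ?M = "\<lambda>j. max_entry (col A j)"
    define h where "h j = (if j \<in> ?Z then \<epsilon> / (real (card ?Z) * ?M j) else 0)" for j
    have g: "g = vec N h" using False by (simp add: g_def mwu_g_def Let_def h_def [abs_def])
    have M_ge: "A $$ (i, j) \<le> ?M j" if "i < m" "j < N" for i j
      using le_max_entry[of i "col A j"] that by simp
    have M_pos: "0 < ?M j" if "j < N" for j
      using col_nonzero[OF that] M_ge[OF _ that] by force
    have fin: "finite ?Z" using B0_sub B_sub finite_subset[of ?Z "{..<N}"] by auto
    have card_pos: "0 < card ?Z" using fin False by (simp add: card_gt_0_iff)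
    have card_le: "card ?Z \<le> N"
      using card_mono[of "{..<N}" ?Z] B0_sub B_sub by auto
    have dim: "dim_vec g = N" by (simp add: g)
    have nonneg: "\<And>j. j < N \<Longrightarrow> 0 \<le> g $ j"
      using M_pos eps_pos card_pos by (simp add: g h_def less_imp_le)
    have upper: "(A *\<^sub>v g) $ i \<le> \<epsilon>" if i: "i < m" for i
    proof -
      have "(A *\<^sub>v g) $ i = (\<Sum>j<N. A $$ (i, j) * h j)"
        unfolding index_mult[OF dim i] by (simp add: g)
      \<comment> \<open>Dividing by the column maximum caps the contribution of each column of
        \<open>mwu_B0\<close> to any row at an equal share of \<epsilon>.\<close>
      also have "\<dots> \<le> (\<Sum>j<N. if j \<in> ?Z then \<epsilon> / card ?Z else 0)"
      proof (rule sum_mono)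
        fix j assume "j \<in> {..<N}"
        then have j: "j < N" by simp
        have "A $$ (i, j) * (\<epsilon> / (real (card ?Z) * ?M j))
            \<le> ?M j * (\<epsilon> / (real (card ?Z) * ?M j))"
          using M_ge[OF i j] M_pos[OF j] eps_pos by (intro mult_right_mono) auto
        also have "\<dots> = \<epsilon> / card ?Z" using M_pos[OF j] by simp
        finally show "A $$ (i, j) * h j \<le> (if j \<in> ?Z then \<epsilon> / card ?Z else 0)"
          by (simp add: h_def)
      qed
      also have "\<dots> = (\<Sum>j\<in>?Z. \<epsilon> / card ?Z)"
        using B0_sub B_sub by (subst sum.inter_restrict[symmetric]) (auto simp: Int_absorb1)
      also have "\<dots> = \<epsilon>" using card_pos by simp
      finally show ?thesis .
    qed
    \<comment> \<open>In the row where column \<open>j\<close> attains its maximum, this column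
      alone contributes its full share.\<close>
    obtain j where j: "j \<in> ?Z" "j < N" using False B0_sub B_sub by auto
    obtain i where i: "i < m" "?M j = A $$ (i, j)"
      using max_entry_attained[of "col A j"] m_ge_2 j(2) by auto
    have "\<epsilon> / N \<le> \<epsilon> / card ?Z"
      using card_pos card_le eps_pos by (intro divide_left_mono) auto
    also have "\<dots> = A $$ (i, j) * g $ j"
      using j M_pos[OF j(2)] i by (simp add: g h_def)
    also have "\<dots> \<le> (A *\<^sub>v g) $ i"
      by (rule entry_le_mult[OF dim nonneg i(1) j(2)])
    finally have "\<exists>i<m. \<epsilon> / N \<le> (A *\<^sub>v g) $ i" using i by blast
    moreover have "\<forall>j<N. j \<notin> ?B \<longrightarrow> g $ j = 0" using B0_sub by (auto simp: g h_def)
    ultimately show ?thesis using dim nonneg upper by blast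
  next
    case True
    \<comment> \<open>The increment is linear in its scale, so
      \<open>\<epsilon> / linf_norm (A *\<^sub>v ?u)\<close> witnesses the choice of \<delta> once
      that norm is positive. It is, because column \<open>j0\<close> has a positive entry and,
      \<open>mwu_B0\<close> being empty, \<open>x\<close> is nonzero at \<open>j0\<close>.\<close>
    let ?u = "mwu_scaled A \<epsilon> s 1"
    have u: "dim_vec ?u = N" "\<And>j. j < N \<Longrightarrow> 0 \<le> ?u $ j" using x by (auto simp: mwu_scaled_def)
    have scaled: "mwu_scaled A \<epsilon> s d = d \<cdot>\<^sub>v ?u" for d
      by (rule eq_vecI) (auto simp: mwu_scaled_def)
    have A_scaled: "A *\<^sub>v mwu_scaled A \<epsilon> s d = d \<cdot>\<^sub>v (A *\<^sub>v ?u)" for d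
      unfolding scaled[of d] by (rule mult_mat_vec[OF A_carrier carrier_vecI[OF u(1)]])
    have norm_scaled: "linf_norm (A *\<^sub>v mwu_scaled A \<epsilon> s d) = \<bar>d\<bar> * linf_norm (A *\<^sub>v ?u)" for d
      unfolding A_scaled[of d] using m_ge_2 by (intro linf_norm_smult) simp
    have jN: "j0 < N" using j0 B_sub by auto
    then obtain i where i: "i < m" "0 < A $$ (i, j0)" using col_nonzero by blast
    have "?x $ j0 \<noteq> 0" using True j0 by (auto simp: mwu_B0_def)
    then have "0 < A $$ (i, j0) * ?u $ j0"
      using i x jN j0 by (simp add: mwu_scaled_def less_le)
    also have "\<dots> \<le> (A *\<^sub>v ?u) $ i" by (rule entry_le_mult[OF u i(1) jN])
    also have "\<dots> \<le> linf_norm (A *\<^sub>v ?u)"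
      using abs_index_le_linf_norm[of i "A *\<^sub>v ?u"] i by (simp del: index_mult_mat_vec)
    finally have pos: "0 < linf_norm (A *\<^sub>v ?u)" .
    define d where "d = (SOME \<delta>. \<delta> > 0 \<and> linf_norm (A *\<^sub>v mwu_scaled A \<epsilon> s \<delta>) = \<epsilon>)"
    have "\<epsilon> / linf_norm (A *\<^sub>v ?u) > 0 \<and>
        linf_norm (A *\<^sub>v mwu_scaled A \<epsilon> s (\<epsilon> / linf_norm (A *\<^sub>v ?u))) = \<epsilon>"
      using pos eps_pos by (subst norm_scaled) simp
    then have d: "d > 0 \<and> linf_norm (A *\<^sub>v mwu_scaled A \<epsilon> s d) = \<epsilon>"
      unfolding d_def by (rule someI)
    have g: "g = mwu_scaled A \<epsilon> s d" using True by (simp add: g_def mwu_g_def d_def)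
    have dim: "dim_vec g = N" by (simp add: g mwu_scaled_def)
    have nonneg: "\<And>j. j < N \<Longrightarrow> 0 \<le> g $ j" using d x by (auto simp: g mwu_scaled_def)
    have upper: "(A *\<^sub>v g) $ i \<le> \<epsilon>" if "i < m" for i
      using abs_index_le_linf_norm[of i "A *\<^sub>v g"] that d by (simp add: g del: index_mult_mat_vec)
    obtain k where k: "k < m" "\<epsilon> = \<bar>(A *\<^sub>v g) $ k\<bar>"
      using linf_norm_attained[of "A *\<^sub>v g"] m_ge_2 d by (auto simp: g simp del: index_mult_mat_vec)
    have "\<epsilon> / N \<le> \<epsilon>" using N_ge_1 eps_pos by (simp add: field_simps)
    also have "\<epsilon> = (A *\<^sub>v g) $ k" using k mult_nonneg[OF dim nonneg k(1)] by simp
    finally have "\<exists>i<m. \<epsilon> / N \<le> (A *\<^sub>v g) $ i" using k by blast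
    moreover have "\<forall>j<N. j \<notin> ?B \<longrightarrow> g $ j = 0" by (auto simp: g mwu_scaled_def)
    ultimately show ?thesis using dim nonneg upper by blast
  qed
  then show "dim_vec g = N"
    and "\<And>j. j < N \<Longrightarrow> 0 \<le> g $ j"
    and "\<And>j. j < N \<Longrightarrow> j \<notin> mwu_B A \<epsilon> s \<Longrightarrow> g $ j = 0"
    and "\<And>i. i < m \<Longrightarrow> (A *\<^sub>v g) $ i \<le> \<epsilon>"
    and "\<exists>i<m. \<epsilon> / N \<le> (A *\<^sub>v g) $ i"
    by blast+
qed

text \<open>
  The potential grows by at least 1 per iteration: an increment raises some row of \<open>A x\<close> by
  \<open>\<epsilon> / N\<close>, and otherwise \<open>\<lambda>\<close> is multiplied by \<open>1 + \<epsilon>\<close>.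
\<close>

definition mwu_potential :: "mwu_state \<Rightarrow> real" where
  "mwu_potential s =
     N / \<epsilon> * (\<Sum>i<m. (A *\<^sub>v mwu_x s) $ i) + ln (mwu_lambda s) / ln (1 + \<epsilon>)"

text \<open>Row \<open>i\<close> has its weight multiplied by \<open>1 + a i\<close> with
  \<open>0 \<le> a i \<le> \<epsilon>\<close>, so its logarithm grows by between
  \<open>a i / (1 + \<epsilon>)\<close> and \<open>a i\<close>, which preserves both bounds on
  \<open>ln w\<close>. As \<lambda> and \<open>y\<close> stay fixed and weights only grow, the
  remaining work is the bound on the total weight.\<close>

lemma mwu_step_increment:
  assumes inv: "mwu_inv s"
    and cheap: "min_entry (A\<^sup>T *\<^sub>v mwu_w s) < (1 + \<epsilon>) * mwu_lambda s"
  shows "mwu_inv (mwu_step A \<epsilon> s) \<and> mwu_potential s + 1 \<le> mwu_potential (mwu_step A \<epsilon> s)"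
proof -
  define g where "g = mwu_g A \<epsilon> s"
  note g = mwu_increment[OF inv cheap, folded g_def]
  define x w l y where xwly: "x = mwu_x s" "w = mwu_w s" "l = mwu_lambda s" "y = mwu_y s"
  define w' where "w' = entrywise_prod w (ones_vec m + A *\<^sub>v g)"
  have step: "mwu_x (mwu_step A \<epsilon> s) = x + g" "mwu_w (mwu_step A \<epsilon> s) = w'"
    "mwu_lambda (mwu_step A \<epsilon> s) = l" "mwu_y (mwu_step A \<epsilon> s) = y"
    using cheap by (simp_all add: mwu_step_def Let_def g_def w'_def xwly)
  have dims': "dim_vec x = N" "dim_vec w = m" "dim_vec w' = m"
    using inv by (simp_all add: mwu_inv_def xwly w'_def entrywise_prod_def)
  have x: "\<And>j. j < N \<Longrightarrow> 0 \<le> x $ j" and w: "\<And>i. i < m \<Longrightarrow> 0 < w $ i"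
    and low: "\<And>i. i < m \<Longrightarrow> (A *\<^sub>v x) $ i / (1 + \<epsilon>) \<le> ln (w $ i)"
    and up: "\<And>i. i < m \<Longrightarrow> ln (w $ i) \<le> (A *\<^sub>v x) $ i"
    and l: "0 < l" "\<And>j. j < N \<Longrightarrow> l \<le> (A\<^sup>T *\<^sub>v w) $ j"
    and y: "covering_feasible A y" "0 < entry_sum y"
    and yw: "entry_sum y \<le> entry_sum w / l"
    and lnw: "ln (entry_sum w) \<le> ln m + (1 + \<epsilon>) * entry_sum x / entry_sum y"
    using inv by (auto simp: mwu_inv_def xwly simp del: index_mult_mat_vec)
  define a where "a i = (A *\<^sub>v g) $ i" for i
  have a: "0 \<le> a i" "a i \<le> \<epsilon>" if "i < m" for i
    using mult_nonneg[OF g(1,2) that] g(4)[OF that] by (auto simp: a_def)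
  have w': "w' $ i = w $ i * (1 + a i)" if "i < m" for i
    using that dims' by (simp add: w'_def entrywise_prod_def ones_vec_def a_def del: index_mult_mat_vec)
  have w'_pos: "0 < w' $ i" if "i < m" for i
    using w'[OF that] w[OF that] a(1)[OF that] by simp
  have ww': "w $ i \<le> w' $ i" if "i < m" for i
    using w'[OF that] w[OF that] a(1)[OF that] by (simp add: algebra_simps)
  have Axg: "(A *\<^sub>v (x + g)) $ i = (A *\<^sub>v x) $ i + a i" if "i < m" for i
    using that dims' g(1) by (simp add: index_mult a_def sum.distrib algebra_simps del: index_mult_mat_vec)
  have lnw': "ln (w' $ i) = ln (w $ i) + ln (1 + a i)" if "i < m" for i
    using w'[OF that] w[OF that] a(1)[OF that] by (simp add: ln_mult)
  have low': "(A *\<^sub>v (x + g)) $ i / (1 + \<epsilon>) \<le> ln (w' $ i)" if "i < m" for i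
    unfolding Axg[OF that] lnw'[OF that] add_divide_distrib
    using low[OF that] divide_le_ln_one_plus[OF a[OF that]] by linarith
  have up': "ln (w' $ i) \<le> (A *\<^sub>v (x + g)) $ i" if "i < m" for i
    unfolding Axg[OF that] lnw'[OF that]
    using up[OF that] ln_add_one_self_le_self[OF a(1)[OF that]] by linarith
  have l': "l \<le> (A\<^sup>T *\<^sub>v w') $ j" if "j < N" for j
    using l(2)[OF that] transpose_mult_mono[OF dims'(2,3) ww' that] by simp
  have W: "0 < entry_sum w" using entry_sum_pos dims' w by blast
  have WW': "entry_sum w \<le> entry_sum w'"
    unfolding entry_sum_eq dims' by (rule sum_mono) (simp add: ww')
  have yw': "entry_sum y \<le> entry_sum w' / l"
    using yw WW' l(1) by (meson divide_right_mono less_imp_le order_trans)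
  have g0: "0 \<le> entry_sum g" unfolding entry_sum_eq using g(1,2) by (auto intro: sum_nonneg)
  have "entry_sum w' = entry_sum w + (\<Sum>i<m. w $ i * (A *\<^sub>v g) $ i)"
    by (simp add: entry_sum_eq dims' w' algebra_simps sum.distrib a_def del: index_mult_mat_vec)
  also have "(\<Sum>i<m. w $ i * (A *\<^sub>v g) $ i) = (\<Sum>j<N. (A\<^sup>T *\<^sub>v w) $ j * g $ j)"
    by (rule sum_mult_transpose[OF g(1) dims'(2)])
  \<comment> \<open>Only columns of \<open>mwu_B\<close> carry mass, and each of them costs less
    than \<open>(1 + \<epsilon>) * l\<close>.\<close>
  also have "\<dots> \<le> (\<Sum>j<N. (1 + \<epsilon>) * l * g $ j)"
  proof (rule sum_mono)
    fix j assume "j \<in> {..<N}"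
    then have j: "j < N" by simp
    show "(A\<^sup>T *\<^sub>v w) $ j * g $ j \<le> (1 + \<epsilon>) * l * g $ j"
    proof (cases "j \<in> mwu_B A \<epsilon> s")
      case True
      then show ?thesis using g(2)[OF j]
        by (intro mult_right_mono) (auto simp: mwu_B_def xwly simp del: index_mult_mat_vec)
    qed (simp add: g(3)[OF j] del: index_mult_mat_vec)
  qed
  also have "\<dots> = (1 + \<epsilon>) * entry_sum g * l"
    by (simp add: entry_sum_eq g(1) sum_distrib_left mult_ac)
  \<comment> \<open>The invariant relating \<open>y\<close> and \<open>w\<close> trades \<lambda>
    for the dual value, which makes the growth multiplicative in the total weight.\<close>
  also have "\<dots> \<le> (1 + \<epsilon>) * entry_sum g * (entry_sum w / entry_sum y)"
    using yw y(2) l(1) g0 eps_pos by (intro mult_left_mono) (auto simp: field_simps)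
  also have "entry_sum w + \<dots> = entry_sum w * (1 + (1 + \<epsilon>) * entry_sum g / entry_sum y)"
    by (simp add: algebra_simps add_divide_distrib)
  finally have bound: "entry_sum w' \<le> entry_sum w * (1 + (1 + \<epsilon>) * entry_sum g / entry_sum y)"
    by simp
  let ?t = "(1 + \<epsilon>) * entry_sum g / entry_sum y"
  have t: "0 \<le> ?t" using g0 y(2) eps_pos by simp
  have "ln (entry_sum w') \<le> ln (entry_sum w * (1 + ?t))"
    using bound W WW' by (intro ln_mono) auto
  also have "\<dots> = ln (entry_sum w) + ln (1 + ?t)"
    using W t by (simp add: ln_mult)
  also have "\<dots> \<le> ln m + (1 + \<epsilon>) * entry_sum x / entry_sum y + ?t"
    using lnw ln_add_one_self_le_self[OF t] by linarith
  also have "\<dots> = ln m + (1 + \<epsilon>) * entry_sum (x + g) / entry_sum y"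
    using g(1) dims' by (simp add: entry_sum_add add_divide_distrib[symmetric] algebra_simps)
  finally have "ln (entry_sum w') \<le> ln m + (1 + \<epsilon>) * entry_sum (x + g) / entry_sum y" .
  then have "mwu_inv (mwu_step A \<epsilon> s)"
    unfolding mwu_inv_def step
    using dims' g(1,2) x w'_pos low' up' l(1) l' y yw'
    by (simp del: index_mult_mat_vec)
  moreover have "mwu_potential s + 1 \<le> mwu_potential (mwu_step A \<epsilon> s)"
  proof -
    obtain i where i: "i < m" "\<epsilon> / N \<le> a i" using g(5) by (auto simp: a_def)
    have "a i \<le> (\<Sum>i<m. a i)" using i a by (intro member_le_sum) auto
    with i have "\<epsilon> / N \<le> (\<Sum>i<m. a i)" by linarith
    then have "1 \<le> N / \<epsilon> * (\<Sum>i<m. a i)" using N_ge_1 eps_pos by (simp add: field_simps)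
    moreover have "(\<Sum>i<m. (A *\<^sub>v (x + g)) $ i) = (\<Sum>i<m. (A *\<^sub>v x) $ i) + (\<Sum>i<m. a i)"
      unfolding sum.distrib[symmetric] by (rule sum.cong) (simp_all add: Axg del: index_mult_mat_vec)
    ultimately show ?thesis
      unfolding mwu_potential_def step xwly(1,3)[symmetric] by (simp add: distrib_left)
  qed
  ultimately show ?thesis ..
qed

text \<open>The failed test says that every column costs at least the new \<lambda>, so
  \<open>w\<close> divided by it is feasible. The objective of \<open>y\<close> never increases,
  which only weakens the bound on the total weight, as \<open>x\<close> and \<open>w\<close> are
  unchanged.\<close>

lemma mwu_step_rescale:
  assumes inv: "mwu_inv s"
    and expensive: "\<not> min_entry (A\<^sup>T *\<^sub>v mwu_w s) < (1 + \<epsilon>) * mwu_lambda s"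
  shows "mwu_inv (mwu_step A \<epsilon> s) \<and> mwu_potential s + 1 \<le> mwu_potential (mwu_step A \<epsilon> s)"
proof -
  define x w l y where xwly: "x = mwu_x s" "w = mwu_w s" "l = mwu_lambda s" "y = mwu_y s"
  define l' where "l' = (1 + \<epsilon>) * l"
  define y' where "y' = (if entry_sum w / l' < entry_sum y then (1 / l') \<cdot>\<^sub>v w else y)"
  have step: "mwu_x (mwu_step A \<epsilon> s) = x" "mwu_w (mwu_step A \<epsilon> s) = w"
    "mwu_lambda (mwu_step A \<epsilon> s) = l'" "mwu_y (mwu_step A \<epsilon> s) = y'"
    using expensive by (simp_all add: mwu_step_def Let_def l'_def y'_def xwly)
  have dim: "dim_vec x = N" "dim_vec w = m"
    and x: "\<And>j. j < N \<Longrightarrow> 0 \<le> x $ j" and w: "\<And>i. i < m \<Longrightarrow> 0 < w $ i"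
    and low: "\<And>i. i < m \<Longrightarrow> (A *\<^sub>v x) $ i / (1 + \<epsilon>) \<le> ln (w $ i)"
    and up: "\<And>i. i < m \<Longrightarrow> ln (w $ i) \<le> (A *\<^sub>v x) $ i"
    and l: "0 < l"
    and y: "covering_feasible A y" "0 < entry_sum y"
    and lnw: "ln (entry_sum w) \<le> ln m + (1 + \<epsilon>) * entry_sum x / entry_sum y"
    using inv by (auto simp: mwu_inv_def xwly simp del: index_mult_mat_vec)
  have l'pos: "0 < l'" using l eps_pos by (simp add: l'_def)
  have l'le: "l' \<le> (A\<^sup>T *\<^sub>v w) $ j" if "j < N" for j
    using expensive min_entry_le[of j "A\<^sup>T *\<^sub>v w"] that
    by (simp add: l'_def xwly del: index_mult_mat_vec)
  have W: "0 < entry_sum w" using entry_sum_pos dim w by blast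
  have cf: "covering_feasible A y'"
    using rescaled_covering_feasible[OF dim(2) w l'pos l'le] y by (simp add: y'_def)
  have y'pos: "0 < entry_sum y'" using W l'pos y by (simp add: y'_def entry_sum_smult)
  have y'le: "entry_sum y' \<le> entry_sum w / l'" "entry_sum y' \<le> entry_sum y"
    by (auto simp: y'_def entry_sum_smult)
  have "0 \<le> entry_sum x" unfolding entry_sum_eq using x dim by (auto intro: sum_nonneg)
  then have "(1 + \<epsilon>) * entry_sum x / entry_sum y \<le> (1 + \<epsilon>) * entry_sum x / entry_sum y'"
    using y'le y'pos eps_pos by (intro divide_left_mono) auto
  with lnw have "ln (entry_sum w) \<le> ln m + (1 + \<epsilon>) * entry_sum x / entry_sum y'" by linarith
  then have "mwu_inv (mwu_step A \<epsilon> s)"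
    unfolding mwu_inv_def step using dim x w low up l'pos l'le cf y'pos y'le
    by (simp del: index_mult_mat_vec)
  moreover have "mwu_potential s + 1 \<le> mwu_potential (mwu_step A \<epsilon> s)"
  proof -
    have "ln l' = ln (1 + \<epsilon>) + ln l" unfolding l'_def using l eps_pos by (simp add: ln_mult)
    then show ?thesis
      unfolding mwu_potential_def step using eps_pos
      by (simp add: add_divide_distrib xwly del: index_mult_mat_vec)
  qed
  ultimately show ?thesis ..
qed

section \<open>Termination\<close>

text \<open>The guard bounds every row of \<open>A x\<close> by \<eta>, hence every weight by
  \<open>exp \<eta>\<close>, and \<lambda> is at most the cost of column 0 at such weights. None of
  these bounds depends on the state.\<close>

lemma mwu_potential_bounded:
  obtains K where "\<And>s. mwu_inv s \<Longrightarrow> mwu_guard A \<epsilon> s \<Longrightarrow> mwu_potential s \<le> K"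
proof -
  define \<eta> where "\<eta> = ln m / \<epsilon>"
  define L where "L = (\<Sum>i<m. A $$ (i, 0) * exp \<eta>)"
  have "mwu_potential s \<le> N / \<epsilon> * (\<Sum>i<m. \<eta>) + ln L / ln (1 + \<epsilon>)"
    if inv: "mwu_inv s" and guard: "mwu_guard A \<epsilon> s" for s
  proof -
    have Ax: "(A *\<^sub>v mwu_x s) $ i \<le> \<eta>" if "i < m" for i
      using abs_index_le_linf_norm[of i "A *\<^sub>v mwu_x s"] guard that
      by (simp add: mwu_guard_def \<eta>_def del: index_mult_mat_vec)
    have w: "mwu_w s $ i \<le> exp \<eta>" if "i < m" for i
    proof -
      have "0 < mwu_w s $ i" "ln (mwu_w s $ i) \<le> \<eta>"
        using inv Ax[OF that] that by (fastforce simp: mwu_inv_def simp del: index_mult_mat_vec)+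
      then show ?thesis by (metis exp_le_cancel_iff exp_ln)
    qed
    have lam: "0 < mwu_lambda s" "mwu_lambda s \<le> (A\<^sup>T *\<^sub>v mwu_w s) $ 0" "dim_vec (mwu_w s) = m"
      using inv N_ge_1 by (auto simp: mwu_inv_def simp del: index_mult_mat_vec)
    have "(A\<^sup>T *\<^sub>v mwu_w s) $ 0 \<le> L"
      unfolding L_def using N_ge_1 lam(3) w A_nonneg
      by (subst index_transpose_mult) (auto intro!: sum_mono mult_left_mono)
    with lam have "ln (mwu_lambda s) \<le> ln L" by (intro ln_mono) auto
    moreover have "(\<Sum>i<m. (A *\<^sub>v mwu_x s) $ i) \<le> (\<Sum>i<m. \<eta>)" using Ax by (intro sum_mono) auto
    ultimately show ?thesis
      unfolding mwu_potential_def using eps_pos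
      by (intro add_mono mult_left_mono divide_right_mono) auto
  qed
  then show ?thesis using that by blast
qed

lemma mwu_terminates:
  obtains s where "while_option (mwu_guard A \<epsilon>) (mwu_step A \<epsilon>) (mwu_init A) = Some s"
    "mwu_inv s" "\<not> mwu_guard A \<epsilon> s"
proof -
  have step: "mwu_inv (mwu_step A \<epsilon> s) \<and> mwu_potential s + 1 \<le> mwu_potential (mwu_step A \<epsilon> s)"
    if "mwu_inv s" for s
    using mwu_step_increment[OF that] mwu_step_rescale[OF that] by blast
  obtain K where K: "\<And>s. mwu_inv s \<Longrightarrow> mwu_guard A \<epsilon> s \<Longrightarrow> mwu_potential s \<le> K"
    using mwu_potential_bounded by blast
  \<comment> \<open>The summand 1 makes \<open>f s\<close> positive whenever the guard holds, so the
    truncation by \<open>nat\<close> cannot hide the decrease.\<close>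
  define f where "f s = nat \<lfloor>K + 1 - mwu_potential s\<rfloor>" for s
  have "f (mwu_step A \<epsilon> s) < f s" if "mwu_inv s" "mwu_guard A \<epsilon> s" for s
    using K[OF that] step[OF that(1)] unfolding f_def by linarith
  then obtain s where s: "while_option (mwu_guard A \<epsilon>) (mwu_step A \<epsilon>) (mwu_init A) = Some s"
    using measure_while_option_Some[of mwu_inv "mwu_guard A \<epsilon>" "mwu_step A \<epsilon>" f "mwu_init A"]
      step mwu_inv_init by blast
  have "mwu_inv s"
    using while_option_rule[of mwu_inv, OF _ s mwu_inv_init] step by blast
  with s while_option_stop[OF s] show ?thesis using that by blast
qed

section \<open>The duality gap at exit\<close>

lemma mwu_output_near_tight:
  assumes inv: "mwu_inv s" and stop: "\<not> mwu_guard A \<epsilon> s"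
  defines "x \<equiv> (1 / linf_norm (A *\<^sub>v mwu_x s)) \<cdot>\<^sub>v mwu_x s"
  shows "packing_feasible A x"
    and "(1 - 3 * \<epsilon>) * entry_sum (mwu_y s) \<le> entry_sum x"
proof -
  define n X Y W where nXYW: "n = linf_norm (A *\<^sub>v mwu_x s)" "X = entry_sum (mwu_x s)"
    "Y = entry_sum (mwu_y s)" "W = entry_sum (mwu_w s)"
  have dim: "dim_vec (mwu_x s) = N" "dim_vec (mwu_w s) = m"
    and xs: "\<And>j. j < N \<Longrightarrow> 0 \<le> mwu_x s $ j" and ws: "\<And>i. i < m \<Longrightarrow> 0 < mwu_w s $ i"
    and low: "\<And>i. i < m \<Longrightarrow> (A *\<^sub>v mwu_x s) $ i / (1 + \<epsilon>) \<le> ln (mwu_w s $ i)"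
    and Y: "0 < Y"
    and lnW: "ln W \<le> ln m + (1 + \<epsilon>) * X / Y"
    using inv by (auto simp: mwu_inv_def nXYW simp del: index_mult_mat_vec)
  have "0 < ln (real m)" using m_ge_2 by simp
  then have eta: "0 < ln m / \<epsilon>" using eps_pos by simp
  have n: "ln m / \<epsilon> \<le> n" using stop by (simp add: mwu_guard_def nXYW)
  with eta have n0: "0 < n" by linarith
  have x: "x = (1 / n) \<cdot>\<^sub>v mwu_x s" by (simp add: x_def nXYW)
  have Ax: "(A *\<^sub>v x) $ i = (A *\<^sub>v mwu_x s) $ i / n" if "i < m" for i
    using that dim by (simp add: x index_mult sum_divide_distrib del: index_mult_mat_vec)
  have "(A *\<^sub>v mwu_x s) $ i \<le> n" if "i < m" for i
    using abs_index_le_linf_norm[of i "A *\<^sub>v mwu_x s"] that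
    by (simp add: nXYW del: index_mult_mat_vec)
  then show "packing_feasible A x"
    using n0 dim xs Ax by (auto simp: packing_feasible_iff x simp del: index_mult_mat_vec)
  \<comment> \<open>The weight of a row attaining the norm is by itself a lower bound on the total
    weight.\<close>
  obtain i where i: "i < m" "n = \<bar>(A *\<^sub>v mwu_x s) $ i\<bar>"
    using linf_norm_attained[of "A *\<^sub>v mwu_x s"] m_ge_2
    by (auto simp: nXYW simp del: index_mult_mat_vec)
  then have "n = (A *\<^sub>v mwu_x s) $ i" using mult_nonneg[OF dim(1) xs i(1)] by simp
  then have "n / (1 + \<epsilon>) \<le> ln (mwu_w s $ i)" using low[OF i(1)] by simp
  also have "mwu_w s $ i \<le> W"
    unfolding nXYW entry_sum_eq dim using i ws
    by (intro member_le_sum[of i "{..<m}" "\<lambda>i. mwu_w s $ i"]) (auto simp: less_imp_le)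
  then have "ln (mwu_w s $ i) \<le> ln W" using ws[OF i(1)] by (intro ln_mono) auto
  also note lnW
  \<comment> \<open>The failed guard turns the initial term \<open>ln m\<close> into a relative
    error of \<epsilon>.\<close>
  also have "ln m \<le> \<epsilon> * n" using n eps_pos by (simp add: field_simps)
  finally have main: "n / (1 + \<epsilon>) \<le> \<epsilon> * n + (1 + \<epsilon>) * X / Y" by simp
  \<comment> \<open>Three losses of order \<epsilon> add up here: the logarithmic lower bound, the
    term \<open>ln m\<close>, and the tolerance \<open>1 + \<epsilon>\<close> in the column
    costs.\<close>
  have "(1 - 3 * \<epsilon>) * (1 + \<epsilon>) \<le> 1 / (1 + \<epsilon>) - \<epsilon>"
  proof -
    have "1 - \<epsilon> \<le> 1 / (1 + \<epsilon>)" using eps_pos by (simp add: field_simps)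
    moreover have "(1 - 3 * \<epsilon>) * (1 + \<epsilon>) \<le> 1 - 2 * \<epsilon>" using eps_pos by (simp add: algebra_simps)
    ultimately show ?thesis by linarith
  qed
  then have "(1 - 3 * \<epsilon>) * (1 + \<epsilon>) * n \<le> (1 / (1 + \<epsilon>) - \<epsilon>) * n"
    using n0 by (intro mult_right_mono) auto
  also have "\<dots> \<le> (1 + \<epsilon>) * X / Y" using main by (simp add: algebra_simps)
  finally have "(1 + \<epsilon>) * ((1 - 3 * \<epsilon>) * n) \<le> (1 + \<epsilon>) * (X / Y)" by (simp add: mult_ac)
  then have "(1 - 3 * \<epsilon>) * n \<le> X / Y" using eps_pos by (subst (asm) mult_le_cancel_left_pos) auto
  then have "(1 - 3 * \<epsilon>) * Y \<le> X / n" using Y n0 by (simp add: field_simps)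
  then show "(1 - 3 * \<epsilon>) * entry_sum (mwu_y s) \<le> entry_sum x"
    by (simp add: x entry_sum_smult nXYW)
qed

lemma parallel_mwu_correct:
  "\<exists>x y. parallel_mwu A \<epsilon> = Some (x, y) \<and>
     packing_optimal_within (1 - 6 * \<epsilon>) A x \<and> covering_feasible A y \<and>
     (\<epsilon> \<le> 1 / 6 \<longrightarrow> covering_optimal_within (1 + 6 * \<epsilon>) A y)"
proof -
  obtain s where s: "while_option (mwu_guard A \<epsilon>) (mwu_step A \<epsilon>) (mwu_init A) = Some s"
    "mwu_inv s" "\<not> mwu_guard A \<epsilon> s"
    using mwu_terminates by blast
  have y: "covering_feasible A (mwu_y s)" using s(2) by (simp add: mwu_inv_def)
  note x = mwu_output_near_tight[OF s(2,3)]
  show ?thesis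
    using near_tight_pair_optimal[OF x(1) y x(2)] y s(1)
    by (simp add: parallel_mwu_def mwu_output_def)
qed

end

theorem theorem3p3:
  shows "\<exists>C > (0::real). \<exists>\<epsilon>\<^sub>0 > (0::real).
    \<forall>(m::nat) (N::nat) (A::real mat) (\<epsilon>::real).
      m \<ge> 2 \<longrightarrow> N \<ge> 1 \<longrightarrow> A \<in> carrier_mat m N \<longrightarrow> 0\<^sub>m m N \<le> A \<longrightarrow>
      (\<forall>j<N. col A j \<noteq> 0\<^sub>v m) \<longrightarrow> \<epsilon> > 0 \<longrightarrow>
      (\<exists>x y. parallel_mwu A \<epsilon> = Some (x, y) \<and>
             packing_optimal_within (1 - C * \<epsilon>) A x \<and>
             covering_feasible A y \<and>
             (\<epsilon> \<le> \<epsilon>\<^sub>0 \<longrightarrow> covering_optimal_within (1 + C * \<epsilon>) A y))"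
\<comment> \<open>Both constants come from \<open>near_tight_pair_optimal\<close>; neither depends
  on the dimensions or on \<open>A\<close>.\<close>
proof (rule exI[of _ 6], intro conjI exI[of _ "1 / 6"] allI impI)
  fix m N :: nat and A :: "real mat" and \<epsilon> :: real
  assume m: "m \<ge> 2" and N: "N \<ge> 1" and A: "A \<in> carrier_mat m N" and nonneg: "0\<^sub>m m N \<le> A"
    and col: "\<forall>j<N. col A j \<noteq> 0\<^sub>v m" and e: "\<epsilon> > 0"
  have ge: "0 \<le> A $$ (i, j)" if "i < m" "j < N" for i j
    using nonneg A that by (auto simp: less_eq_mat_def)
  have "\<exists>i<m. 0 < A $$ (i, j)" if j: "j < N" for j
  proof (rule ccontr)
    assume "\<not> ?thesis"
    then have "A $$ (i, j) = 0" if "i < m" for i using ge[OF that j] that by force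
    then have "col A j = 0\<^sub>v m" using A j by (intro eq_vecI) auto
    with col j show False by blast
  qed
  then interpret mwu_instance A m N \<epsilon>
    using m N A ge e by unfold_locales auto
  show "\<exists>x y. parallel_mwu A \<epsilon> = Some (x, y) \<and>
      packing_optimal_within (1 - 6 * \<epsilon>) A x \<and> covering_feasible A y \<and>
      (\<epsilon> \<le> 1 / 6 \<longrightarrow> covering_optimal_within (1 + 6 * \<epsilon>) A y)"
    by (rule parallel_mwu_correct)
qed simp_all

end
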